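(* Let $n$ be an integer with $n\ge 4$. Then $$\mathrm{CC}(n,n-3)=\binom{\left\lceil\frac{n}{2}\right\rceil}{2}+\binom{\left\lfloor\frac{n}{2}\right\rfloor}{2}+1 .$$
   Context: For integers $n\ge r+1$, $r\ge 1$, an $(n,r+1,r)$-covering is a family $\mathcal{B}$ of $(r+1)$-subsets of $\{1,\ldots,n\}$, called blocks, such that each $r$-subset of $\{1,\ldots,n\}$ is contained in at least one block. Its size is the number of blocks. The graph $G(\mathcal{B})$ has the blocks as vertices, and two distinct blocks are adjacent if they have an $r$-subset in common (i.e. their intersection has exactly $r$ elements). The covering is connected if $G(\mathcal{B})$ is connected. $\mathrm{CC}(n,r)$ denotes the minimum size of a connected $(n,r+1,r)$-covering. *)

theory Defs
  imports Complex_Main "Graph_Theory.Graph_Theory"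
begin

definition covering :: "nat \<Rightarrow> nat \<Rightarrow> nat set set \<Rightarrow> bool" where
  "covering n r \<B> \<longleftrightarrow>
     (\<forall>B\<in>\<B>. B \<subseteq> {1..n} \<and> card B = r + 1) \<and>
     (\<forall>R. R \<subseteq> {1..n} \<and> card R = r \<longrightarrow> (\<exists>B\<in>\<B>. R \<subseteq> B))"

text \<open>
  Following the convention of Graph_Theory, the undirected graph is the digraph that has
  both arcs (A, C) and (C, A) for each pair of adjacent blocks.
\<close>

definition covering_graph :: "nat \<Rightarrow> nat set set \<Rightarrow> nat set pair_pre_digraph" where
  "covering_graph r \<B> =
     \<lparr>pverts = \<B>, parcs = {(A, C). A \<in> \<B> \<and> C \<in> \<B> \<and> A \<noteq> C \<and> card (A \<inter> C) = r}\<rparr>"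

lemma pair_graph_covering_graph:
  assumes "finite \<B>"
  shows "pair_graph (covering_graph r \<B>)"
proof
  show "finite (parcs (covering_graph r \<B>))"
    by (rule finite_subset[of _ "\<B> \<times> \<B>"]) (use assms in \<open>auto simp: covering_graph_def\<close>)
  show "symmetric (with_proj (covering_graph r \<B>))"
    by (auto simp: covering_graph_def symmetric_def arcs_ends_def arc_to_ends_def Int_commute
        intro!: symI)
qed (use assms in \<open>auto simp: covering_graph_def\<close>)

text \<open>
  The unqualified name connected may denote topological connectedness, hence the long name.
\<close>

definition connected_covering :: "nat \<Rightarrow> nat \<Rightarrow> nat set set \<Rightarrow> bool" where
  "connected_covering n r \<B> \<longleftrightarrow>
     covering n r \<B> \<and> Digraph_Component.connected (with_proj (covering_graph r \<B>))"

definition CC :: "nat \<Rightarrow> nat \<Rightarrow> nat" where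
  "CC n r = (LEAST s. \<exists>\<B>. connected_covering n r \<B> \<and> card \<B> = s)"

text \<open>
  The family of all blocks is a connected covering, so the minimum in CC ranges over a
  nonempty set whenever r < n.
\<close>

lemma ex_connected_covering:
  assumes "r < n"
  shows "\<exists>\<B>. connected_covering n r \<B>"
proof
  define \<B> where "\<B> = {B. B \<subseteq> {1..n} \<and> card B = r + 1}"
  have fin: "finite B" if "B \<in> \<B>" for B
    using that finite_subset[of B "{1..n}"] by (auto simp: \<B>_def)
  have cov: "covering n r \<B>"
  proof -
    have "\<exists>B\<in>\<B>. R \<subseteq> B" if R: "R \<subseteq> {1..n}" "card R = r" for R
    proof -
      have fR: "finite R" using R(1) finite_subset by blast
      have "card R \<noteq> card {1..n}" using R(2) assms by simp
      then have "R \<noteq> {1..n}" by blast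
      then obtain x where "x \<in> {1..n}" "x \<notin> R" using R by blast
      then have "insert x R \<in> \<B>" using R fR by (simp add: \<B>_def)
      then show ?thesis by blast
    qed
    moreover have "\<forall>B\<in>\<B>. B \<subseteq> {1..n} \<and> card B = r + 1" by (simp add: \<B>_def)
    ultimately show ?thesis unfolding covering_def by blast
  qed
  have ne: "\<B> \<noteq> {}"
  proof -
    have "{1..r+1} \<in> \<B>" using assms by (simp add: \<B>_def)
    then show ?thesis by blast
  qed
  let ?E = "(arcs_ends (with_proj (covering_graph r \<B>)))\<^sup>s"
  have "(A, C) \<in> rtrancl_on \<B> ?E" if "A \<in> \<B>" "C \<in> \<B>" "card (A - C) = k" for A C k
    using that
  proof (induction k arbitrary: A)
    case 0
    have "finite (A - C)" using fin[OF 0(1)] by simp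
    then have "A \<subseteq> C" using 0(3) by simp
    moreover have "card A = card C" using 0(1,2) by (simp add: \<B>_def)
    ultimately have "A = C" using fin[OF 0(2)] by (simp add: card_subset_eq)
    then show ?case using 0(1) by simp
  next
    case (Suc k)
    have fA: "finite A" and fC: "finite C" using Suc.prems fin by auto
    have "A - C \<noteq> {}" using Suc.prems(3) by (intro notI) simp
    then obtain x where x: "x \<in> A" "x \<notin> C" by blast
    have "\<not> C \<subseteq> A"
    proof
      assume "C \<subseteq> A"
      moreover have "card C = card A" using Suc.prems by (simp add: \<B>_def)
      ultimately have "C = A" using fA by (simp add: card_subset_eq)
      then show False using x by blast
    qed
    then obtain y where y: "y \<in> C" "y \<notin> A" by blast
    define D where "D = insert y (A - {x})"
    have D: "D \<in> \<B>" using Suc.prems x y fA by (auto simp: D_def \<B>_def)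
    have "D - C = (A - C) - {x}" using x y by (auto simp: D_def)
    then have "card (D - C) = k" using Suc.prems(3) x fA by simp
    then have DC: "(D, C) \<in> rtrancl_on \<B> ?E" using Suc.IH[OF D Suc.prems(2)] by simp
    have "A \<inter> D = A - {x}" using y by (auto simp: D_def)
    then have "card (A \<inter> D) = r" using Suc.prems x fA by (simp add: \<B>_def)
    moreover have "A \<noteq> D" using y by (auto simp: D_def)
    ultimately have "(A, D) \<in> ?E"
      using Suc.prems D
      by (auto simp: covering_graph_def arcs_ends_def arc_to_ends_def symcl_def)
    then show ?case using DC Suc.prems(1) by (rule converse_rtrancl_on_into_rtrancl_on)
  qed
  then have "Digraph_Component.connected (with_proj (covering_graph r \<B>))"
    unfolding connected_conv using ne by (simp add: covering_graph_def)
  with cov show "connected_covering n r \<B>" by (simp add: connected_covering_def)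
qed

end

theory Submission
  imports Defs
begin

text \<open>
  Pass from each block to its complement. For \<open>r = n - 3\<close> the complements are pairs, so a family
  of blocks is the same thing as the edge set \<open>E\<close> of a graph \<open>H\<close> on \<open>V = {1..n}\<close>. The covering
  property says that every triple contains an edge, i.e. that \<open>H\<close> has no independent triple, and
  two blocks are adjacent exactly when the corresponding edges share one vertex. Hence
  \<open>CC n (n - 3)\<close> is the least number of edges of a graph on \<open>n\<close> vertices that has no independent
  triple and all of whose edges lie in a single component
  (\<open>connected_covering_complements_iff\<close>).

  Two disjoint cliques of sizes \<open>\<lfloor>n/2\<rfloor>\<close> and \<open>\<lceil>n/2\<rceil>\<close>, joined by one further edge, form such a graph
  (\<open>joined_cliques_connected\<close>). For the lower bound, let \<open>u\<close> and \<open>v\<close> be nonadjacent. Every other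
  vertex is adjacent to \<open>u\<close> or \<open>v\<close>, and the common neighbours are adjacent to both, so deleting
  \<open>u\<close> and \<open>v\<close> destroys at least \<open>n - 2\<close> edges, plus one for each common neighbour
  (\<open>card_edges_delete_nonadjacent\<close>). Induction on the number of vertices gives Mantel's bound
  \<open>\<lfloor>n/2\<rfloor> choose 2 + \<lceil>n/2\<rceil> choose 2\<close> (\<open>mantel_complement\<close>); if some nonadjacent pair has a common
  neighbour, deleting this pair first gains the additional one. If no nonadjacent pair has a common
  neighbour, then every component of \<open>H\<close> is a clique. As the edges lie in one component, the
  remaining vertices are isolated, and there is at most one of them, since otherwise two of them
  and a vertex of the clique would be an independent triple. So \<open>H\<close> has at least
  \<open>(n - 1) choose 2\<close> edges, which for \<open>n \<ge> 4\<close> is again enough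
  (\<open>card_edges_ge_if_connected\<close>).
\<close>

section \<open>Graphs without independent triples\<close>

definition pairs :: "'a set \<Rightarrow> 'a set set" where
  "pairs V = {e. e \<subseteq> V \<and> card e = 2}"

definition no_independent_triple :: "'a set \<Rightarrow> 'a set set \<Rightarrow> bool" where
  "no_independent_triple V E \<longleftrightarrow> (\<forall>T. T \<subseteq> V \<and> card T = 3 \<longrightarrow> (\<exists>e\<in>E. e \<subseteq> T))"

text \<open>
  Connectedness of the line graph, phrased through closed sets of edges rather than walks, so that
  it transports along complementation without any manipulation of walks.
\<close>

definition edges_connected :: "'a set set \<Rightarrow> bool" where
  "edges_connected E \<longleftrightarrow> E \<noteq> {} \<and>
     (\<forall>S. S \<subseteq> E \<and> S \<noteq> {} \<and> (\<forall>e\<in>S. \<forall>f\<in>E. e \<inter> f \<noteq> {} \<longrightarrow> f \<in> S) \<longrightarrow> S = E)"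

lemma card_pairs: "finite V \<Longrightarrow> card (pairs V) = card V choose 2"
  unfolding pairs_def by (rule n_subsets)

lemma finite_pairs: "finite V \<Longrightarrow> finite (pairs V)"
  by (rule finite_subset[of _ "Pow V"]) (auto simp: pairs_def)

lemma pairs_insert_iff: "{x, y} \<in> pairs V \<longleftrightarrow> x \<in> V \<and> y \<in> V \<and> x \<noteq> y"
  by (auto simp: pairs_def card_2_iff doubleton_eq_iff)

lemma edge_endpoints:
  assumes "{x, y} \<in> E" "E \<subseteq> pairs V"
  shows "x \<in> V" "y \<in> V" "x \<noteq> y"
  using subsetD[OF assms(2,1)] by (simp_all add: pairs_insert_iff)

lemma pairsE:
  assumes "e \<in> pairs V"
  obtains x y where "e = {x, y}" "x \<in> V" "y \<in> V" "x \<noteq> y"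
  using assms by (auto simp: pairs_def card_2_iff)

lemma no_independent_tripleD:
  assumes "no_independent_triple V E" "E \<subseteq> pairs V"
    and "x \<in> V" "y \<in> V" "z \<in> V" "x \<noteq> y" "x \<noteq> z" "y \<noteq> z"
  shows "{x, y} \<in> E \<or> {x, z} \<in> E \<or> {y, z} \<in> E"
proof -
  have "{x, y, z} \<subseteq> V \<and> card {x, y, z} = 3" using assms by simp
  then obtain e where e: "e \<in> E" "e \<subseteq> {x, y, z}"
    using assms(1) unfolding no_independent_triple_def by blast
  then obtain a b where ab: "e = {a, b}" "a \<noteq> b" using assms(2) by (meson pairsE subsetD)
  have "e = {x, y} \<or> e = {x, z} \<or> e = {y, z}" using e(2) ab by auto
  then show ?thesis using e(1) by auto
qed

lemma no_independent_triple_restrict: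
  assumes "no_independent_triple V E" "E \<subseteq> pairs V" "W \<subseteq> V"
  shows "no_independent_triple W (E \<inter> pairs W)"
  unfolding no_independent_triple_def
proof (intro allI impI)
  fix T assume T: "T \<subseteq> W \<and> card T = 3"
  then obtain e where "e \<in> E" "e \<subseteq> T"
    using assms(1,3) unfolding no_independent_triple_def by (meson order_trans)
  moreover have "e \<in> pairs W" using calculation assms(2) T by (auto simp: pairs_def)
  ultimately show "\<exists>e\<in>E \<inter> pairs W. e \<subseteq> T" by blast
qed

text \<open>
  Each vertex other than \<open>u\<close> and \<open>v\<close> sends at least one edge to the pair, as the triple it forms
  with \<open>u\<close> and \<open>v\<close> is not independent; common neighbours send two.
\<close>

lemma card_edges_delete_nonadjacent:
  assumes fin: "finite V" and E: "E \<subseteq> pairs V" and tri: "no_independent_triple V E"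
    and uv: "u \<in> V" "v \<in> V" "u \<noteq> v" "{u, v} \<notin> E"
  shows "card V - 2 + card {w. {u, w} \<in> E \<and> {v, w} \<in> E} + card (E \<inter> pairs (V - {u, v})) \<le> card E"
proof -
  define N where "N a = {w. {a, w} \<in> E}" for a
  define E1 where "E1 = {e \<in> E. u \<in> e \<or> v \<in> e}"
  have finE: "finite E" using finite_subset[OF E finite_pairs[OF fin]] .
  have NV: "N a \<subseteq> V - {a}" for a
  proof
    fix w assume "w \<in> N a"
    then have "{a, w} \<in> E" by (simp add: N_def)
    then show "w \<in> V - {a}" using edge_endpoints[OF _ E, of a w] by auto
  qed
  have vuE: "{v, u} \<notin> E" using uv(4) by (simp add: insert_commute)
  have finN: "finite (N a)" for a using NV fin by (meson finite_Diff finite_subset)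
  have N: "N u \<union> N v = V - {u, v}"
  proof
    have "v \<notin> N u" "u \<notin> N v" using uv(4) vuE by (simp_all add: N_def)
    then show "N u \<union> N v \<subseteq> V - {u, v}" using NV[of u] NV[of v] by blast
    show "V - {u, v} \<subseteq> N u \<union> N v"
    proof
      fix w assume "w \<in> V - {u, v}"
      then have "{u, v} \<in> E \<or> {u, w} \<in> E \<or> {v, w} \<in> E"
        using uv by (intro no_independent_tripleD[OF tri E]) auto
      then show "w \<in> N u \<union> N v" using uv(4) by (simp add: N_def)
    qed
  qed
  have inj: "inj_on (\<lambda>w. {a, w}) A" for a :: 'a and A
    by (rule inj_onI) (simp add: doubleton_eq_iff, metis)
  have disj: "(\<lambda>w. {u, w}) ` N u \<inter> (\<lambda>w. {v, w}) ` N v = {}"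
  proof -
    have "v \<notin> N u" using uv(4) by (simp add: N_def)
    then show ?thesis using uv(3) by (auto simp: doubleton_eq_iff)
  qed
  have "card V - 2 + card (N u \<inter> N v) = card (N u \<union> N v) + card (N u \<inter> N v)"
    unfolding N using uv fin by (simp add: card_Diff_subset)
  also have "\<dots> = card (N u) + card (N v)" using card_Un_Int[OF finN finN, of u v] by simp
  also have "\<dots> = card ((\<lambda>w. {u, w}) ` N u \<union> (\<lambda>w. {v, w}) ` N v)"
    using finN disj by (simp add: card_Un_disjoint card_image inj)
  also have "\<dots> \<le> card E1"
    using finE by (intro card_mono) (auto simp: E1_def N_def)
  finally have 1: "card V - 2 + card (N u \<inter> N v) \<le> card E1" .
  have "E1 \<union> (E \<inter> pairs (V - {u, v})) \<subseteq> E" by (auto simp: E1_def)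
  moreover have "E1 \<inter> (E \<inter> pairs (V - {u, v})) = {}" by (auto simp: E1_def pairs_def)
  ultimately have "card E1 + card (E \<inter> pairs (V - {u, v})) \<le> card E"
    using finE by (metis card_Un_disjoint card_mono finite_Un finite_subset)
  moreover have "N u \<inter> N v = {w. {u, w} \<in> E \<and> {v, w} \<in> E}" by (auto simp: N_def)
  ultimately show ?thesis using 1 by simp
qed

section \<open>The lower bound\<close>

definition two_clique_edges :: "nat \<Rightarrow> nat" where
  "two_clique_edges n = ((n + 1) div 2 choose 2) + (n div 2 choose 2)"

lemma two_clique_edges_add_2: "two_clique_edges (n + 2) = two_clique_edges n + n"
proof -
  have s: "Suc k choose 2 = (k choose 2) + k" for k
    by (simp add: numeral_2_eq_2)
  have "(n + 2 + 1) div 2 = Suc ((n + 1) div 2)" "(n + 2) div 2 = Suc (n div 2)" by auto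
  moreover have "(n + 1) div 2 + n div 2 = n" by presburger
  ultimately show ?thesis by (simp only: two_clique_edges_def s)
qed

lemma two_clique_edges_le_choose: "two_clique_edges n \<le> n choose 2"
proof (induction n rule: less_induct)
  case (less n)
  show ?case
  proof (cases "n < 2")
    case True
    then show ?thesis by (auto simp: two_clique_edges_def less_2_cases_iff)
  next
    case False
    then obtain k where k: "n = k + 2" by (metis add.commute le_Suc_ex not_less)
    have "k + 2 choose 2 = (k choose 2) + k + (k + 1)" by (simp add: numeral_2_eq_2)
    then show ?thesis using less[of k] k two_clique_edges_add_2[of k] by simp
  qed
qed

lemma two_clique_edges_less_choose:
  assumes "n \<ge> 4"
  shows "two_clique_edges n < n - 1 choose 2"
  using assms
proof (induction n rule: less_induct)
  case (less n)
  consider "n = 4" | "n = 5" | "n \<ge> 6" using less.prems by linarith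
  then show ?case
  proof cases
    case 3
    then obtain k where k: "n = Suc k + 2" "k \<ge> 3" by (intro that[of "n - 3"]) auto
    have "k + 2 choose 2 = (k choose 2) + k + (k + 1)" by (simp add: numeral_2_eq_2)
    then show ?thesis using less.IH[of "Suc k"] k two_clique_edges_add_2[of "Suc k"] by simp
  qed (simp_all add: two_clique_edges_def choose_two)
qed

text \<open>
  This is Mantel's theorem for the complementary graph, which is triangle-free. Deleting a
  nonadjacent pair of vertices costs exactly the increment of \<open>two_clique_edges\<close>; a graph without
  such a pair is complete.
\<close>

lemma mantel_complement:
  assumes "finite V" "E \<subseteq> pairs V" "no_independent_triple V E"
  shows "two_clique_edges (card V) \<le> card E"
  using assms
proof (induction "card V" arbitrary: V E rule: less_induct)
  case less
  show ?case
  proof (cases "pairs V \<subseteq> E")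
    case True
    then have "E = pairs V" using less.prems by auto
    then show ?thesis using less.prems(1) by (simp add: card_pairs two_clique_edges_le_choose)
  next
    case False
    then obtain u v where uv: "u \<in> V" "v \<in> V" "u \<noteq> v" "{u, v} \<notin> E" by (metis pairsE subsetI)
    let ?W = "V - {u, v}"
    have "card {u, v} \<le> card V" using uv less.prems(1) by (intro card_mono) auto
    then have V: "card V = card ?W + 2" using uv less.prems(1) by (simp add: card_Diff_subset)
    have "two_clique_edges (card ?W) \<le> card (E \<inter> pairs ?W)"
      using less.prems V by (intro less.hyps no_independent_triple_restrict) auto
    then show ?thesis
      using card_edges_delete_nonadjacent[OF less.prems uv] V
        two_clique_edges_add_2[of "card ?W"] by simp
  qed
qed

text \<open>
  A nonadjacent pair with a common neighbour improves Mantel's bound by one. In the absence of such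
  a pair, adjacency is transitive and the edges form a clique that misses at most one vertex.
\<close>

lemma card_edges_ge_if_connected:
  assumes fin: "finite V" and n: "card V \<ge> 4"
    and E: "E \<subseteq> pairs V" and tri: "no_independent_triple V E" and conn: "edges_connected E"
  shows "two_clique_edges (card V) + 1 \<le> card E"
proof (cases "\<exists>u v w. {u, w} \<in> E \<and> {v, w} \<in> E \<and> u \<noteq> v \<and> {u, v} \<notin> E")
  case True
  then obtain u v w where w: "{u, w} \<in> E" "{v, w} \<in> E" "u \<noteq> v" "{u, v} \<notin> E" by blast
  then have uv: "u \<in> V" "v \<in> V" using edge_endpoints[OF _ E] by blast+
  let ?W = "V - {u, v}"
  have V: "card V = card ?W + 2" using uv w(3) fin n by (simp add: card_Diff_subset)
  have "{w. {u, w} \<in> E \<and> {v, w} \<in> E} \<subseteq> V"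
    using edge_endpoints[OF _ E] by auto
  then have "finite {w. {u, w} \<in> E \<and> {v, w} \<in> E}" using fin finite_subset by blast
  then have "1 \<le> card {w. {u, w} \<in> E \<and> {v, w} \<in> E}"
    using w by (auto simp: Suc_le_eq card_gt_0_iff)
  moreover have "two_clique_edges (card ?W) \<le> card (E \<inter> pairs ?W)"
    using fin E tri by (intro mantel_complement no_independent_triple_restrict) auto
  ultimately show ?thesis
    using card_edges_delete_nonadjacent[OF fin E tri uv w(3,4)] V
      two_clique_edges_add_2[of "card ?W"] by simp
next
  case False
  then have trans: "{x, z} \<in> E" if "{x, y} \<in> E" "{y, z} \<in> E" "x \<noteq> z" for x y z
  proof -
    have "{z, y} \<in> E" using that(2) by (simp add: insert_commute)
    then show ?thesis using False that(1,3) by blast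
  qed
  obtain e where "e \<in> E" using conn by (auto simp: edges_connected_def)
  then obtain a b where ab: "{a, b} \<in> E" "a \<in> V" using E by (metis pairsE subsetD)
  define K where "K = insert a {x. {a, x} \<in> E}"
  have KV: "K \<subseteq> V" using edge_endpoints[OF _ E] ab(2) by (auto simp: K_def)
  have clique: "{x, y} \<in> E" if "x \<in> K" "y \<in> K" "x \<noteq> y" for x y
    using that trans[of x a y] by (auto simp: K_def insert_commute)
  have step: "y \<in> K" if "x \<in> K" "{x, y} \<in> E" for x y
    using that trans[of a x y] by (auto simp: K_def)
  \<comment> \<open>The edges inside \<open>K\<close> are closed under sharing a vertex, hence they are all the edges.\<close>
  have "{f \<in> E. f \<subseteq> K} = E"
  proof -
    have "{f \<in> E. f \<subseteq> K} \<noteq> {}" using ab by (auto simp: K_def)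
    moreover have "g \<subseteq> K" if fg: "f \<subseteq> K" "g \<in> E" "f \<inter> g \<noteq> {}" for f g
    proof -
      obtain x where x: "x \<in> f" "x \<in> g" using fg(3) by blast
      obtain p q where "g = {p, q}" using fg(2) E by (meson pairsE subsetD)
      then obtain y where "g = {x, y}" using x(2) by auto
      then show ?thesis using step[of x y] x fg by auto
    qed
    ultimately have "{f \<in> E. f \<subseteq> K} \<noteq> {} \<and>
        (\<forall>f\<in>{f \<in> E. f \<subseteq> K}. \<forall>g\<in>E. f \<inter> g \<noteq> {} \<longrightarrow> g \<in> {f \<in> E. f \<subseteq> K})"
      by blast
    then show ?thesis
      using conn[unfolded edges_connected_def, THEN conjunct2, THEN spec, of "{f \<in> E. f \<subseteq> K}"]
      by simp
  qed
  then have "E \<subseteq> {f \<in> E. f \<subseteq> K}" by (rule equalityD2)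
  then have inK: "x \<in> K \<and> y \<in> K" if "{x, y} \<in> E" for x y using subsetD[OF _ that] by auto
  have "x = y" if "x \<in> V - K" "y \<in> V - K" for x y
  proof (rule ccontr)
    assume "x \<noteq> y"
    moreover have "a \<in> K" by (simp add: K_def)
    ultimately have "{a, x} \<in> E \<or> {a, y} \<in> E \<or> {x, y} \<in> E"
      using that ab(2) by (intro no_independent_tripleD[OF tri E]) auto
    then show False using inK[of a x] inK[of a y] inK[of x y] that by blast
  qed
  then have "card (V - K) \<le> 1" by (metis One_nat_def card.infinite card_le_Suc0_iff_eq le0)
  then have "card V - 1 \<le> card K"
    using fin KV by (simp add: card_Diff_subset finite_subset)
  then have "card V - 1 choose 2 \<le> card K choose 2" by (rule binomial_right_mono)
  also have "\<dots> = card (pairs K)" using finite_subset[OF KV fin] by (simp add: card_pairs)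
  also have "\<dots> \<le> card E"
    using clique finite_subset[OF E finite_pairs[OF fin]]
    by (intro card_mono) (auto elim!: pairsE)
  finally show ?thesis using two_clique_edges_less_choose[OF n] by linarith
qed

section \<open>Two joined cliques\<close>

lemma joined_cliques_no_independent_triple:
  "no_independent_triple (L \<union> R) (insert e (pairs L \<union> pairs R))"
  unfolding no_independent_triple_def
proof (intro allI impI)
  fix T assume T: "T \<subseteq> L \<union> R \<and> card T = 3"
  then obtain x y z where xyz: "T = {x, y, z}" "x \<noteq> y" "y \<noteq> z" "x \<noteq> z"
    by (auto simp: card_3_iff)
  \<comment> \<open>Two of the three vertices lie in the same clique.\<close>
  then have "{x, y} \<in> pairs L \<union> pairs R \<or> {x, z} \<in> pairs L \<union> pairs R \<or> {y, z} \<in> pairs L \<union> pairs R"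
    using T by (auto simp: pairs_insert_iff)
  moreover have "{x, y} \<subseteq> T" "{x, z} \<subseteq> T" "{y, z} \<subseteq> T" using xyz(1) by auto
  ultimately show "\<exists>f\<in>insert e (pairs L \<union> pairs R). f \<subseteq> T" by (meson insertI2)
qed

text \<open>
  If every edge is at distance at most two from \<open>b\<close> in the line graph, a nonempty closed set first
  reaches \<open>b\<close> and from there every edge.
\<close>

lemma edges_connected_if_hub:
  assumes b: "b \<in> E" and near: "\<And>f. f \<in> E \<Longrightarrow> \<exists>g\<in>E. f \<inter> g \<noteq> {} \<and> g \<inter> b \<noteq> {}"
  shows "edges_connected E"
  unfolding edges_connected_def
proof (intro conjI allI impI)
  show "E \<noteq> {}" using b by blast
next
  fix S assume "S \<subseteq> E \<and> S \<noteq> {} \<and> (\<forall>e\<in>S. \<forall>f\<in>E. e \<inter> f \<noteq> {} \<longrightarrow> f \<in> S)"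
  then have S: "S \<subseteq> E" "S \<noteq> {}" and closed: "\<And>e f. e \<in> S \<Longrightarrow> f \<in> E \<Longrightarrow> e \<inter> f \<noteq> {} \<Longrightarrow> f \<in> S"
    by auto
  obtain e where e: "e \<in> S" using S(2) by blast
  then obtain g where g: "g \<in> E" "e \<inter> g \<noteq> {}" "g \<inter> b \<noteq> {}" using near S(1) by blast
  have bS: "b \<in> S" using closed[OF closed[OF e g(1,2)] b g(3)] .
  have "f \<in> S" if f: "f \<in> E" for f
  proof -
    obtain g where g: "g \<in> E" "f \<inter> g \<noteq> {}" "g \<inter> b \<noteq> {}" using near[OF f] by blast
    then have "b \<inter> g \<noteq> {}" "g \<inter> f \<noteq> {}" by (simp_all add: Int_commute)
    then show ?thesis using closed[OF closed[OF bS g(1)] f] by simp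
  qed
  then show "S = E" using S(1) by blast
qed

lemma joined_cliques_connected:
  assumes "p \<in> L" "q \<in> R"
  shows "edges_connected (insert {p, q} (pairs L \<union> pairs R))"
proof (rule edges_connected_if_hub)
  fix f assume f: "f \<in> insert {p, q} (pairs L \<union> pairs R)"
  \<comment> \<open>A vertex of a clique is joined within it to the end of the bridge, unless it is that end.\<close>
  have *: "\<exists>g\<in>insert {p, q} (pairs L \<union> pairs R). f \<inter> g \<noteq> {} \<and> g \<inter> {p, q} \<noteq> {}"
    if x: "x \<in> f" "x \<in> K" and r: "r \<in> K" "r = p \<or> r = q" and K: "K = L \<or> K = R" for x r K
  proof (cases "x = r")
    case True
    then show ?thesis using x r by (intro bexI[of _ "{p, q}"]) auto
  next
    case False
    then have "{r, x} \<in> pairs L \<union> pairs R" using x r K by (auto simp: pairs_insert_iff)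
    then show ?thesis using x r by (intro bexI[of _ "{r, x}"]) auto
  qed
  consider "f = {p, q}"
    | x where "f \<in> pairs L" "x \<in> f" "x \<in> L"
    | x where "f \<in> pairs R" "x \<in> f" "x \<in> R"
    using f by (metis Un_iff insertE insertI1 pairsE)
  then show "\<exists>g\<in>insert {p, q} (pairs L \<union> pairs R). f \<inter> g \<noteq> {} \<and> g \<inter> {p, q} \<noteq> {}"
    by cases (use assms *[of p L p] *[of _ L p] *[of _ R q] in simp_all)
qed simp

lemma card_joined_cliques:
  assumes "finite L" "finite R" "L \<inter> R = {}" "p \<in> L" "q \<in> R"
  shows "card (insert {p, q} (pairs L \<union> pairs R)) = (card L choose 2) + (card R choose 2) + 1"
proof -
  have "{p, q} \<notin> pairs L \<union> pairs R" using assms(3-5) by (auto simp: pairs_insert_iff)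
  moreover have "pairs L \<inter> pairs R = {}"
    using assms(3) by (auto elim!: pairsE simp: doubleton_eq_iff)
  ultimately show ?thesis
    using assms(1,2) by (simp add: card_Un_disjoint finite_pairs card_pairs)
qed

section \<open>Coverings as complements of graphs\<close>

text \<open>
  Walks enter only here: the set of blocks reachable from a given block is closed under adjacency,
  and conversely a closed set contains everything reachable from its elements.
\<close>

lemma connected_covering_graph_iff:
  "Digraph_Component.connected (with_proj (covering_graph r \<B>)) \<longleftrightarrow> \<B> \<noteq> {} \<and>
     (\<forall>S. S \<subseteq> \<B> \<and> S \<noteq> {} \<and> (\<forall>A\<in>S. \<forall>C\<in>\<B>. A \<noteq> C \<and> card (A \<inter> C) = r \<longrightarrow> C \<in> S) \<longrightarrow> S = \<B>)"
    (is "?conn \<longleftrightarrow> _ \<and> ?closed")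
proof -
  define D where "D = {(A, C). A \<in> \<B> \<and> C \<in> \<B> \<and> A \<noteq> C \<and> card (A \<inter> C) = r}"
  have D: "(arcs_ends (with_proj (covering_graph r \<B>)))\<^sup>s = D"
    by (auto simp: D_def covering_graph_def arcs_ends_def arc_to_ends_def symcl_def Int_commute)
  have conn: "?conn \<longleftrightarrow> \<B> \<noteq> {} \<and> (\<forall>A\<in>\<B>. \<forall>C\<in>\<B>. (A, C) \<in> rtrancl_on \<B> D)"
    unfolding connected_conv D by (simp add: covering_graph_def)
  have reach: "C \<in> S"
    if "(A, C) \<in> rtrancl_on \<B> D" "A \<in> S" "\<forall>A\<in>S. \<forall>C\<in>\<B>. A \<noteq> C \<and> card (A \<inter> C) = r \<longrightarrow> C \<in> S"
    for A C S
    using that by (induction rule: rtrancl_on_induct) (auto simp: D_def)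
  show ?thesis
  proof (intro iffI conjI)
    assume ?conn
    then show "\<B> \<noteq> {}" by (simp add: conn)
    show ?closed
    proof (intro allI impI)
      fix S assume S: "S \<subseteq> \<B> \<and> S \<noteq> {} \<and> (\<forall>A\<in>S. \<forall>C\<in>\<B>. A \<noteq> C \<and> card (A \<inter> C) = r \<longrightarrow> C \<in> S)"
      then obtain A where A: "A \<in> S" by blast
      have "C \<in> S" if "C \<in> \<B>" for C
        using \<open>?conn\<close> A S that reach[of A C S] unfolding conn by blast
      then show "S = \<B>" using S by blast
    qed
  next
    assume closed: "\<B> \<noteq> {} \<and> ?closed"
    have "{C. (A, C) \<in> rtrancl_on \<B> D} = \<B>" if A: "A \<in> \<B>" for A
    proof -
      let ?S = "{C. (A, C) \<in> rtrancl_on \<B> D}"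
      have "?S \<subseteq> \<B>" using reach[of A _ \<B>] A by blast
      moreover have "A \<in> ?S" using A by simp
      moreover have "C' \<in> ?S" if "C \<in> ?S" "C' \<in> \<B>" "C \<noteq> C'" "card (C \<inter> C') = r" for C C'
      proof -
        have "(C, C') \<in> D" using that \<open>?S \<subseteq> \<B>\<close> by (auto simp: D_def)
        then show ?thesis using that by (auto intro: rtrancl_on_into_rtrancl_on)
      qed
      ultimately show ?thesis
        using closed[THEN conjunct2, THEN spec, of ?S] by blast
    qed
    then show ?conn using closed unfolding conn by blast
  qed
qed

text \<open>
  By inclusion-exclusion the complements share \<open>card V + card (e \<inter> f) - 4\<close> points, and distinct
  pairs share at most one. Adjacency of blocks thus becomes adjacency in the line graph.
\<close>

lemma card_Int_complements_eq_iff: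
  assumes "finite V" "card V \<ge> 3" "e \<in> pairs V" "f \<in> pairs V"
  shows "V - e \<noteq> V - f \<and> card ((V - e) \<inter> (V - f)) = card V - 3 \<longleftrightarrow> e \<noteq> f \<and> e \<inter> f \<noteq> {}"
proof -
  have ef: "e \<subseteq> V" "f \<subseteq> V" "card e = 2" "card f = 2" using assms(3,4) by (auto simp: pairs_def)
  then have fin: "finite e" "finite f" using assms(1) finite_subset by blast+
  have eq: "V - e = V - f \<longleftrightarrow> e = f" using ef by blast
  have "(V - e) \<inter> (V - f) = V - (e \<union> f)" by blast
  then have 1: "card ((V - e) \<inter> (V - f)) = card V - card (e \<union> f)"
    using ef fin by (simp add: card_Diff_subset)
  have 2: "card (e \<union> f) \<le> card V" using ef assms(1) by (intro card_mono) auto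
  have 3: "card (e \<union> f) + card (e \<inter> f) = 4" using card_Un_Int[OF fin] ef by simp
  have 4: "card (e \<inter> f) \<noteq> 2" if "e \<noteq> f"
    using that ef fin by (metis Int_lower1 Int_lower2 card_subset_eq)
  have 5: "card (e \<inter> f) \<le> 2" using card_mono[OF fin(1), of "e \<inter> f"] ef by simp
  have 6: "card (e \<inter> f) = 0 \<longleftrightarrow> e \<inter> f = {}" using fin by simp
  show ?thesis unfolding eq 1 6[symmetric] using 2 3 4 5 assms(2) by (cases "e = f") (simp, linarith)
qed

lemma card_complement:
  assumes "finite V" "X \<subseteq> V"
  shows "card (V - X) = card V - card X"
  using assms by (simp add: card_Diff_subset finite_subset)

text \<open>
  The block \<open>{1..n} - e\<close> contains the set \<open>R\<close> exactly when \<open>e\<close> lies in the complement of \<open>R\<close>, which is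
  a triple.
\<close>

lemma covering_complements_iff:
  assumes n: "n \<ge> 3" and E: "E \<subseteq> pairs {1..n}"
  shows "covering n (n - 3) ((-) {1..n} ` E) \<longleftrightarrow> no_independent_triple {1..n} E"
proof -
  let ?V = "{1..n}"
  have card_compl: "card (?V - X) = n - card X" if "X \<subseteq> ?V" for X
    using card_complement[OF _ that] by simp
  have blocks: "B \<subseteq> ?V \<and> card B = n - 3 + 1" if B: "B \<in> (-) ?V ` E" for B
  proof -
    obtain e where e: "e \<in> E" "B = ?V - e" using B by blast
    then have "e \<subseteq> ?V" "card e = 2" using E by (auto simp: pairs_def)
    then show ?thesis using card_compl[of e] e(2) n by auto
  qed
  have "(\<forall>R. R \<subseteq> ?V \<and> card R = n - 3 \<longrightarrow> (\<exists>e\<in>E. R \<subseteq> ?V - e)) \<longleftrightarrow>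
        (\<forall>T. T \<subseteq> ?V \<and> card T = 3 \<longrightarrow> (\<exists>e\<in>E. e \<subseteq> T))" (is "?cov \<longleftrightarrow> ?tri")
  proof (intro iffI allI impI)
    fix T assume ?cov and T: "T \<subseteq> ?V \<and> card T = 3"
    moreover have "?V - T \<subseteq> ?V \<and> card (?V - T) = n - 3" using T card_compl by auto
    ultimately obtain e where "e \<in> E" "?V - T \<subseteq> ?V - e" by blast
    then show "\<exists>e\<in>E. e \<subseteq> T" using E by (auto simp: pairs_def intro!: bexI[of _ e])
  next
    fix R assume ?tri and R: "R \<subseteq> ?V \<and> card R = n - 3"
    moreover have "?V - R \<subseteq> ?V \<and> card (?V - R) = 3" using R card_compl n by auto
    ultimately obtain e where "e \<in> E" "e \<subseteq> ?V - R" by blast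
    then show "\<exists>e\<in>E. R \<subseteq> ?V - e" using R by blast
  qed
  then show ?thesis
    unfolding covering_def no_independent_triple_def using blocks by simp
qed

lemma connected_complements_iff:
  assumes V: "finite V" "card V \<ge> 3" and E: "E \<subseteq> pairs V"
  shows "Digraph_Component.connected (with_proj (covering_graph (card V - 3) ((-) V ` E)))
    \<longleftrightarrow> edges_connected E"
proof -
  have inj: "inj_on ((-) V) E" using E by (auto simp: inj_on_def pairs_def)
  have closed: "(\<forall>A\<in>(-) V ` S. \<forall>C\<in>(-) V ` E.
        A \<noteq> C \<and> card (A \<inter> C) = card V - 3 \<longrightarrow> C \<in> (-) V ` S) \<longleftrightarrow>
      (\<forall>e\<in>S. \<forall>f\<in>E. e \<inter> f \<noteq> {} \<longrightarrow> f \<in> S)" if S: "S \<subseteq> E" for S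
  proof -
    have "(V - e \<noteq> V - f \<and> card ((V - e) \<inter> (V - f)) = card V - 3 \<longrightarrow> V - f \<in> (-) V ` S) \<longleftrightarrow>
        (e \<inter> f \<noteq> {} \<longrightarrow> f \<in> S)" if ef: "e \<in> S" "f \<in> E" for e f
    proof -
      have "e \<in> pairs V" "f \<in> pairs V" using ef S E by auto
      note adj = card_Int_complements_eq_iff[OF V this]
      have "V - f \<in> (-) V ` S \<longleftrightarrow> f \<in> S" by (rule inj_on_image_mem_iff[OF inj ef(2) S])
      then show ?thesis unfolding adj using ef(1) by auto
    qed
    then show ?thesis by (simp only: ball_simps) (intro ball_cong refl)
  qed
  have eq: "(-) V ` S = (-) V ` E \<longleftrightarrow> S = E" if "S \<subseteq> E" for S
    using inj_on_image_eq_iff[OF inj that order_refl] .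
  show ?thesis
    unfolding connected_covering_graph_iff edges_connected_def imp_conjL all_subset_image
    by (simp only: image_is_empty closed[unfolded imp_conjL] eq cong: imp_cong)
qed

lemma connected_covering_complements_iff:
  assumes "n \<ge> 3" "E \<subseteq> pairs {1..n}"
  shows "connected_covering n (n - 3) ((-) {1..n} ` E) \<longleftrightarrow>
    no_independent_triple {1..n} E \<and> edges_connected E"
  unfolding connected_covering_def
  using covering_complements_iff[OF assms] connected_complements_iff[of "{1..n}" E] assms by simp

lemma card_complements:
  assumes "E \<subseteq> pairs V"
  shows "card ((-) V ` E) = card E"
  using assms by (intro card_image) (auto simp: inj_on_def pairs_def)

lemma covering_eq_complements:
  assumes "n \<ge> 3" "covering n (n - 3) \<B>"
  obtains E where "E \<subseteq> pairs {1..n}" "\<B> = (-) {1..n} ` E"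
proof
  have B: "B \<subseteq> {1..n} \<and> card B = n - 2" if "B \<in> \<B>" for B
    using assms that by (auto simp: covering_def)
  have "{1..n} - B \<in> pairs {1..n}" if "B \<in> \<B>" for B
    using card_complement[of "{1..n}" B] B[OF that] assms(1) by (simp add: pairs_def)
  then show "(-) {1..n} ` \<B> \<subseteq> pairs {1..n}" by blast
  have "{1..n} - ({1..n} - B) = B" if "B \<in> \<B>" for B using B[OF that] by blast
  then show "\<B> = (-) {1..n} ` (-) {1..n} ` \<B>" by (simp add: image_image)
qed

section \<open>The minimum\<close>

theorem theorem3p6:
  fixes n :: nat
  assumes "n \<ge> 4"
  shows "CC n (n - 3) = (nat \<lceil>real n / 2\<rceil> choose 2) + (nat \<lfloor>real n / 2\<rfloor> choose 2) + 1"
proof -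
  have n: "n \<ge> 3" using assms by simp
  have "CC n (n - 3) = two_clique_edges n + 1"
    unfolding CC_def
  proof (rule Least_equality)
    let ?L = "{1..n div 2}" and ?R = "{n div 2 + 1..n}"
    let ?E = "insert {1, n} (pairs ?L \<union> pairs ?R)"
    have LR: "?L \<union> ?R = {1..n}" "?L \<inter> ?R = {}" "1 \<in> ?L" "n \<in> ?R" using assms by auto
    have "pairs ?L \<subseteq> pairs {1..n}" "pairs ?R \<subseteq> pairs {1..n}" using LR(1) by (auto simp: pairs_def)
    moreover have "{1, n} \<in> pairs {1..n}" using assms by (simp add: pairs_insert_iff)
    ultimately have E: "?E \<subseteq> pairs {1..n}" by blast
    have "card ?R = (n + 1) div 2" by simp
    then have "card ?E = two_clique_edges n + 1"
      using card_joined_cliques[OF _ _ LR(2-4)] by (simp add: two_clique_edges_def)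
    moreover have "connected_covering n (n - 3) ((-) {1..n} ` ?E)"
      using connected_covering_complements_iff[OF n E] joined_cliques_connected[OF LR(3,4)]
        joined_cliques_no_independent_triple[of ?L ?R] unfolding LR(1) by blast
    ultimately show "\<exists>\<B>. connected_covering n (n - 3) \<B> \<and> card \<B> = two_clique_edges n + 1"
      using card_complements[OF E] by metis
  next
    fix s assume "\<exists>\<B>. connected_covering n (n - 3) \<B> \<and> card \<B> = s"
    then obtain \<B> where \<B>: "connected_covering n (n - 3) \<B>" "card \<B> = s" by blast
    then obtain E where E: "E \<subseteq> pairs {1..n}" "\<B> = (-) {1..n} ` E"
      using covering_eq_complements[OF n] unfolding connected_covering_def by metis
    have "no_independent_triple {1..n} E \<and> edges_connected E"
      using \<B>(1) connected_covering_complements_iff[OF n E(1)] E(2) by simp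
    then show "two_clique_edges n + 1 \<le> s"
      using card_edges_ge_if_connected[of "{1..n}" E] E \<B>(2) card_complements[OF E(1)] assms by simp
  qed
  moreover have "nat \<lceil>real n / 2\<rceil> = (n + 1) div 2" "nat \<lfloor>real n / 2\<rfloor> = n div 2" by linarith+
  ultimately show ?thesis by (simp add: two_clique_edges_def)
qed

end
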